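(* Let $\alpha,\beta\in\mathbb{Z}$ and $T\in\mathbb{Q}$ with $\beta T\in\mathbb{Z}$. Suppose that the quartic equation $$s^2v^2+\alpha\,(su^3+t^3v)+\beta\,t^2u^2=T\,stuv \qquad ( * )$$ has a solution of the form $(s,t,u,v)=(A_1,A_2,A_3,A_4)$ with $A_1=\pm1$ and non-zero $A_2,A_3,A_4\in\mathbb{Z}$. Then, provided that the orbit of this set of initial data under the Somos 4 recurrence $$A_{n+4}A_n=\alpha\,A_{n+3}A_{n+1}+\beta\,(A_{n+2})^2$$ is non-periodic, it produces infinitely many integer solutions $(s,t,u,v)=(A_n,A_{n+1},A_{n+2},A_{n+3})$ of the Diophantine equation $( * )$.
   Context: The recurrence is iterated from the four non-zero values $A_1,A_2,A_3,A_4$, and the orbit is the resulting sequence of quadruples $(A_n,A_{n+1},A_{n+2},A_{n+3})$. Non-periodic means that there is no $p\ge1$ with $A_{n+p}=A_n$ for all $n$. Convention on zeros: if a zero term is encountered, the sequence is analytically continued through it. That is, $A_n$ is the value at the given data of the rational function of $\alpha,\beta,A_1,\dots,A_4$ obtained by iterating the recurrence formally; by the Laurent property of Fomin and Zelevinsky this function lies in $\mathbb{Z}[\alpha,\beta,A_1^{\pm1},A_2^{\pm1},A_3^{\pm1},A_4^{\pm1}]$, so it has a well-defined value when $A_1,\dots,A_4$ are non-zero.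
   Formalization: The formal theorem additionally assumes that α and β are not both zero; for α = β = 0 the continued sequence is A_1,…,A_4,0,0,…, which is non-periodic but gives only finitely many quadruples, so the claim fails there. *)

theory Defs
  imports Complex_Main "HOL-Computational_Algebra.Polynomial" "HOL-Computational_Algebra.Fraction_Field"
begin

text \<open>
  The polynomial ring \<open>\<int>[\<alpha>, \<beta>, A\<^sub>1, A\<^sub>2, A\<^sub>3, A\<^sub>4]\<close> as an iterated univariate polynomial ring, with \<open>\<alpha>\<close>
  the innermost and \<open>A\<^sub>4\<close> the outermost variable, and its field of fractions.
\<close>

type_synonym poly6 = "int poly poly poly poly poly poly"

type_synonym ratfun6 = "poly6 fract"

definition X_\<alpha> :: poly6 where "X_\<alpha> = [:[:[:[:[:[:0, 1:]:]:]:]:]:]"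
definition X_\<beta> :: poly6 where "X_\<beta> = [:[:[:[:[:0, 1:]:]:]:]:]"
definition X_1 :: poly6 where "X_1 = [:[:[:[:0, 1:]:]:]:]"
definition X_2 :: poly6 where "X_2 = [:[:[:0, 1:]:]:]"
definition X_3 :: poly6 where "X_3 = [:[:0, 1:]:]"
definition X_4 :: poly6 where "X_4 = [:0, 1:]"

definition const_rf :: "poly6 \<Rightarrow> ratfun6" where
  "const_rf P = Fract P 1"

text \<open>Indices are shifted by one: \<open>somos4_formal n\<close> is \<open>A\<^sub>n\<^sub>+\<^sub>1\<close> as a rational function.\<close>

fun somos4_formal :: "nat \<Rightarrow> ratfun6" where
  "somos4_formal 0 = const_rf X_1"
| "somos4_formal (Suc 0) = const_rf X_2"
| "somos4_formal (Suc (Suc 0)) = const_rf X_3"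
| "somos4_formal (Suc (Suc (Suc 0))) = const_rf X_4"
| "somos4_formal (Suc (Suc (Suc (Suc n)))) =
     (const_rf X_\<alpha> * somos4_formal (Suc (Suc (Suc n))) * somos4_formal (Suc n)
       + const_rf X_\<beta> * (somos4_formal (Suc (Suc n)))\<^sup>2) / somos4_formal n"

text \<open>Evaluation at an integer point substitutes for the outermost variable \<open>A\<^sub>4\<close> first.\<close>

definition eval6 :: "int \<Rightarrow> int \<Rightarrow> int \<Rightarrow> int \<Rightarrow> int \<Rightarrow> int \<Rightarrow> poly6 \<Rightarrow> int" where
  "eval6 \<alpha> \<beta> A1 A2 A3 A4 P =
     poly (poly (poly (poly (poly (poly P (of_int A4)) (of_int A3)) (of_int A2)) (of_int A1))
       (of_int \<beta>)) \<alpha>"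

text \<open>
  A rational function has value \<open>y\<close> at a point if some representation of it as a fraction has a
  denominator that does not vanish there and evaluates to \<open>y\<close>. Other representations of
  the same function may be \<open>0/0\<close> at that point; this is how the sequence is continued
  through a zero term.
\<close>

definition has_value ::
  "int \<Rightarrow> int \<Rightarrow> int \<Rightarrow> int \<Rightarrow> int \<Rightarrow> int \<Rightarrow> ratfun6 \<Rightarrow> rat \<Rightarrow> bool" where
  "has_value \<alpha> \<beta> A1 A2 A3 A4 f y \<longleftrightarrow>
     (\<exists>P Q. Q \<noteq> 0 \<and> f = Fract P Q \<and> eval6 \<alpha> \<beta> A1 A2 A3 A4 Q \<noteq> 0 \<and>
        y = of_int (eval6 \<alpha> \<beta> A1 A2 A3 A4 P) / of_int (eval6 \<alpha> \<beta> A1 A2 A3 A4 Q))"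

lemma eval6_mult:
  "eval6 \<alpha> \<beta> A1 A2 A3 A4 (P * Q) = eval6 \<alpha> \<beta> A1 A2 A3 A4 P * eval6 \<alpha> \<beta> A1 A2 A3 A4 Q"
  by (simp add: eval6_def)

lemma has_value_unique:
  assumes "has_value \<alpha> \<beta> A1 A2 A3 A4 f y" and "has_value \<alpha> \<beta> A1 A2 A3 A4 f z"
  shows "y = z"
proof -
  let ?e = "eval6 \<alpha> \<beta> A1 A2 A3 A4"
  obtain P Q where 1: "Q \<noteq> 0" "f = Fract P Q" "?e Q \<noteq> 0" "y = of_int (?e P) / of_int (?e Q)"
    using assms(1) unfolding has_value_def by blast
  obtain R S where 2: "S \<noteq> 0" "f = Fract R S" "?e S \<noteq> 0" "z = of_int (?e R) / of_int (?e S)"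
    using assms(2) unfolding has_value_def by blast
  have "P * S = R * Q"
    using 1(1,2) 2(1,2) by (simp add: eq_fract)
  then have "?e P * ?e S = ?e R * ?e Q"
    by (metis eval6_mult)
  then have "(of_int (?e P) :: rat) * of_int (?e S) = of_int (?e R) * of_int (?e Q)"
    by (metis of_int_mult)
  then show ?thesis
    using 1(3,4) 2(3,4) by (simp add: frac_eq_eq)
qed

text \<open>
  \<open>somos4 \<alpha> \<beta> A1 A2 A3 A4 n\<close> is the term \<open>A\<^sub>n\<^sub>+\<^sub>1\<close> of the Somos 4 sequence with the given initial data.
  The value exists for non-zero \<open>A1\<close>, \<open>A2\<close>, \<open>A3\<close>, \<open>A4\<close> by the Laurent property of Fomin and Zelevinsky.
\<close>

definition somos4 :: "int \<Rightarrow> int \<Rightarrow> int \<Rightarrow> int \<Rightarrow> int \<Rightarrow> int \<Rightarrow> nat \<Rightarrow> rat" where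
  "somos4 \<alpha> \<beta> A1 A2 A3 A4 n = (THE y. has_value \<alpha> \<beta> A1 A2 A3 A4 (somos4_formal n) y)"

definition quartic :: "int \<Rightarrow> int \<Rightarrow> rat \<Rightarrow> int \<Rightarrow> int \<Rightarrow> int \<Rightarrow> int \<Rightarrow> bool" where
  "quartic \<alpha> \<beta> T s t u v \<longleftrightarrow>
     of_int (s\<^sup>2 * v\<^sup>2 + \<alpha> * (s * u ^ 3 + t ^ 3 * v) + \<beta> * t\<^sup>2 * u\<^sup>2) = T * of_int (s * t * u * v)"

definition periodic :: "(nat \<Rightarrow> 'a) \<Rightarrow> bool" where
  "periodic a \<longleftrightarrow> (\<exists>p\<ge>1. \<forall>n. a (n + p) = a n)"

end

theory Submission
  imports Defs
begin

text \<open>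
  Two facts have to be shown: the orbit consists of integers on the quartic, and an orbit with only
  finitely many quadruples is periodic.

  The first fact is a sharpened Laurent property: every term is a polynomial in
  \<open>\<alpha>\<close>, \<open>\<beta>\<close>, \<open>\<alpha>\<^sup>2 + \<beta> T\<close>, \<open>A\<^sub>1\<close>, \<open>1 / A\<^sub>1\<close>, \<open>A\<^sub>2\<close>, \<open>A\<^sub>3\<close>, \<open>A\<^sub>4\<close> with integer coefficients, so that \<open>A\<^sub>1 = \<plusminus>1\<close> and
  \<open>\<beta> T \<in> \<int>\<close> make all values integral. It rests on the addition formulas of elliptic sequences
  (\<open>addition_formulas\<close>). A Somos 4 sequence \<open>A\<close> on the quartic with parameter \<open>T\<close> has a companion
  elliptic divisibility sequence \<open>W\<close>, depending only on \<open>\<alpha>\<close>, \<open>\<beta>\<close> and \<open>T\<close>, such that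
  \<open>A\<^sub>a\<^sub>+\<^sub>m A\<^sub>a\<^sub>-\<^sub>m = W\<^sub>m\<^sup>2 A\<^sub>a\<^sub>+\<^sub>1 A\<^sub>a\<^sub>-\<^sub>1 - W\<^sub>m\<^sub>-\<^sub>1 W\<^sub>m\<^sub>+\<^sub>1 A\<^sub>a\<^sup>2\<close> and
  \<open>W\<^sub>1 W\<^sub>2 A\<^sub>a\<^sub>+\<^sub>m\<^sub>+\<^sub>1 A\<^sub>a\<^sub>-\<^sub>m = W\<^sub>m W\<^sub>m\<^sub>+\<^sub>1 A\<^sub>a\<^sub>+\<^sub>2 A\<^sub>a\<^sub>-\<^sub>1 - W\<^sub>m\<^sub>-\<^sub>1 W\<^sub>m\<^sub>+\<^sub>2 A\<^sub>a\<^sub>+\<^sub>1 A\<^sub>a\<close>.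
  Putting \<open>a - m = 1\<close> expresses \<open>A\<^sub>1 A\<^sub>n\<close> as a polynomial in earlier terms and companion terms.
  The companion sequence obeys the same formulas and starts with \<open>W\<^sub>1 = 1\<close>, so its terms need no division at all (\<open>companion_in_subring\<close>, \<open>somos4_in_subring\<close>).
  All this takes place in the field of rational functions, where every term that is divided by is
  non-zero, because at \<open>\<alpha> = 4\<close>, \<open>\<beta> = -3\<close> and initial values \<open>1, 2, 3, 4\<close> both sequences become
  \<open>A\<^sub>n = W\<^sub>n = n\<close>. The results are then evaluated at the given point.

  For the second fact, zeros are the difficulty, since a quadruple starting with zero does not determine
  its successor through the Somos 4 recurrence. The odd addition formula with \<open>m = 2\<close> is a
  Somos 5 recurrence, which steps over such a zero because two neighbouring terms never vanish together
  (\<open>no_adjacent_zeros\<close>). Hence five consecutive terms determine the whole sequence in both directions,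
  and a finite orbit repeats from its very first term (\<open>finite_orbit_imp_periodic\<close>).
\<close>

section \<open>Weighted Somos 4 relations and the invariance of the quartic\<close>

text \<open>
  An elliptic sequence \<open>X\<close> may involve \<open>sqrt \<alpha>\<close> in every second term, as the companion sequence below
  does. To stay inside a field that need not contain \<open>sqrt \<alpha>\<close>, write \<open>X\<^sub>n = sqrt (\<eta>\<^sub>n) x\<^sub>n\<close> with a weight
  \<open>\<eta>\<close> of period two. The three relations below are the Somos 4 recurrence, the quartic and a cubic
  consequence of both, for \<open>X\<close>, expressed through \<open>x\<close> and \<open>\<eta>\<close>. An ordinary Somos 4 sequence has
  \<open>\<eta> = 1\<close>.
\<close>

definition somos4_rel :: "'a::field \<Rightarrow> 'a \<Rightarrow> (nat \<Rightarrow> 'a) \<Rightarrow> (nat \<Rightarrow> 'a) \<Rightarrow> nat \<Rightarrow> bool" where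
  "somos4_rel \<alpha> \<beta> \<eta> x n \<longleftrightarrow>
     \<eta> n * x n * x (n + 4) = \<alpha> * \<eta> (n + 1) * x (n + 1) * x (n + 3) + \<beta> * \<eta> n * (x (n + 2))\<^sup>2"

definition quartic_rel ::
  "'a::field \<Rightarrow> 'a \<Rightarrow> 'a \<Rightarrow> (nat \<Rightarrow> 'a) \<Rightarrow> (nat \<Rightarrow> 'a) \<Rightarrow> nat \<Rightarrow> bool" where
  "quartic_rel \<alpha> \<beta> T \<eta> x n \<longleftrightarrow>
     \<eta> n * \<eta> (n + 1) * (x n)\<^sup>2 * (x (n + 3))\<^sup>2
     + \<alpha> * ((\<eta> n)\<^sup>2 * x n * x (n + 2) ^ 3 + (\<eta> (n + 1))\<^sup>2 * x (n + 1) ^ 3 * x (n + 3))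
     + \<beta> * \<eta> n * \<eta> (n + 1) * (x (n + 1))\<^sup>2 * (x (n + 2))\<^sup>2
     = T * \<eta> n * \<eta> (n + 1) * x n * x (n + 1) * x (n + 2) * x (n + 3)"

definition cubic_rel ::
  "'a::field \<Rightarrow> 'a \<Rightarrow> (nat \<Rightarrow> 'a) \<Rightarrow> (nat \<Rightarrow> 'a) \<Rightarrow> nat \<Rightarrow> bool" where
  "cubic_rel \<alpha> T \<eta> x n \<longleftrightarrow>
     \<eta> (n + 1) * (x (n + 4) * (x (n + 1))\<^sup>2 + (x (n + 3))\<^sup>2 * x n) + \<alpha> * \<eta> n * x (n + 2) ^ 3
     = T * \<eta> (n + 1) * x (n + 1) * x (n + 2) * x (n + 3)"

text \<open>
  The invariance of the quartic passes through the cubic: multiplying the cubic relation at \<open>n\<close> by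
  \<open>\<eta>\<^sub>n x\<^sub>n\<close>, or by \<open>\<eta>\<^sub>n x\<^sub>n\<^sub>+\<^sub>4\<close>, and eliminating the product \<open>x\<^sub>n x\<^sub>n\<^sub>+\<^sub>4\<close> by the recurrence gives the quartic
  relation at \<open>n\<close>, respectively at \<open>n + 1\<close>.
\<close>

lemma cubic_from_quartic:
  fixes x :: "nat \<Rightarrow> 'a::field"
  assumes "somos4_rel \<alpha> \<beta> \<eta> x n" and "quartic_rel \<alpha> \<beta> T \<eta> x n" and "\<eta> n \<noteq> 0" and "x n \<noteq> 0"
  shows "cubic_rel \<alpha> T \<eta> x n"
proof -
  have "\<eta> n * x n * (\<eta> (n + 1) * (x (n + 4) * (x (n + 1))\<^sup>2 + (x (n + 3))\<^sup>2 * x n) + \<alpha> * \<eta> n * x (n + 2) ^ 3)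
     = \<eta> n * x n * (T * \<eta> (n + 1) * x (n + 1) * x (n + 2) * x (n + 3))"
    using assms(1,2) unfolding somos4_rel_def quartic_rel_def by algebra
  moreover have "\<eta> n * x n \<noteq> 0"
    using assms(3,4) by simp
  ultimately show ?thesis
    unfolding cubic_rel_def by (simp only: mult_left_cancel not_False_eq_True)
qed

lemma quartic_from_cubic:
  fixes x :: "nat \<Rightarrow> 'a::field"
  assumes "somos4_rel \<alpha> \<beta> \<eta> x n" and "cubic_rel \<alpha> T \<eta> x n" and "\<eta> (n + 2) = \<eta> n"
  shows "quartic_rel \<alpha> \<beta> T \<eta> x (n + 1)"
proof -
  have i: "n + 1 + 1 = n + 2" "n + 1 + 2 = n + 3" "n + 1 + 3 = n + 4" by simp_all
  show ?thesis
    using assms unfolding somos4_rel_def quartic_rel_def cubic_rel_def i by algebra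
qed

lemma quartic_cubic_invariant:
  fixes x :: "nat \<Rightarrow> 'a::field"
  assumes S: "\<And>n. somos4_rel \<alpha> \<beta> \<eta> x n" and "\<And>n. \<eta> (n + 2) = \<eta> n"
    and "\<And>n. \<eta> n \<noteq> 0" and "\<And>n. x n \<noteq> 0" and "quartic_rel \<alpha> \<beta> T \<eta> x 0"
  shows "quartic_rel \<alpha> \<beta> T \<eta> x n" and "cubic_rel \<alpha> T \<eta> x n"
proof -
  show Q: "quartic_rel \<alpha> \<beta> T \<eta> x n"
  proof (induction n)
    case 0
    show ?case by fact
  next
    case (Suc n)
    have "quartic_rel \<alpha> \<beta> T \<eta> x (n + 1)"
      using cubic_from_quartic[OF S Suc assms(3,4)] quartic_from_cubic[OF S _ assms(2)] by blast
    then show ?case by simp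
  qed
  show "cubic_rel \<alpha> T \<eta> x n"
    using cubic_from_quartic[OF S Q assms(3,4)] .
qed

text \<open>
  The weight of the companion sequence, whose even-indexed terms carry a factor \<open>sqrt \<alpha>\<close>.
\<close>

definition parity_weight :: "'a::field \<Rightarrow> nat \<Rightarrow> 'a" where
  "parity_weight \<alpha> n = (if even n then \<alpha> else 1)"

lemma parity_weight_simps:
  "parity_weight \<alpha> (n + 2) = parity_weight \<alpha> n"
  "parity_weight \<alpha> n * parity_weight \<alpha> (n + 1) = \<alpha>"
  "\<alpha> \<noteq> 0 \<Longrightarrow> parity_weight \<alpha> n \<noteq> 0"
  by (simp_all add: parity_weight_def)

text \<open>
  The next two polynomial identities carry the induction for the addition formulas. Here
  \<open>p, q, r, s, t\<close> are consecutive terms of a weighted Somos 4 sequence, with weight \<open>g'\<close> at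
  \<open>p, r, t\<close> and \<open>g\<close> at \<open>q, s\<close>, and \<open>A, B, C, D, F\<close> are consecutive terms of the companion
  sequence. Once \<open>p\<close> and \<open>t\<close> are eliminated by the recurrence and the cubic relation, each side of
  the first identity is, up to a monomial, a polynomial of degree two in \<open>g q s / (g' r\<^sup>2)\<close>.
  The outer coefficients agree at once, and the middle ones agree exactly because the companion sequence satisfies the quartic with the same parameter \<open>T\<close>.
\<close>

lemma even_step_algebra:
  fixes A :: "'a::field"
  assumes "g' * p * t = \<alpha> * g * q * s + \<beta> * g' * r\<^sup>2"
    and "g * (t * q\<^sup>2 + s\<^sup>2 * p) + \<alpha> * g' * r ^ 3 = T * g * q * r * s"
    and "e * e' = \<alpha>"
    and "A\<^sup>2 * D\<^sup>2 + e\<^sup>2 * A * C ^ 3 + e'\<^sup>2 * B ^ 3 * D + \<beta> * B\<^sup>2 * C\<^sup>2 = T * A * B * C * D"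
  shows "g * g' * ((B * C * s * p - A * D * r * q) * (B * C * t * q - A * D * s * r)) =
    (e' * B\<^sup>2 * g * s * q - e * A * C * g' * r\<^sup>2) * (e * C\<^sup>2 * g * s * q - e' * B * D * g' * r\<^sup>2)"
  using assms by algebra

text \<open>
  After elimination by the quartic both sides are polynomials of degree two in \<open>q t / (r s)\<close>.
  The constant coefficient needs the recurrence of the companion sequence and the middle coefficient its cubic relation.
\<close>

lemma odd_step_algebra:
  fixes A :: "'a::field"
  assumes "g * g' * q\<^sup>2 * t\<^sup>2 + \<alpha> * (g\<^sup>2 * q * s ^ 3 + g'\<^sup>2 * r ^ 3 * t) + \<beta> * g * g' * r\<^sup>2 * s\<^sup>2
      = T * g * g' * q * r * s * t"
    and "e * e' = \<alpha>"
    and "F * B\<^sup>2 + D\<^sup>2 * A + e\<^sup>2 * C ^ 3 = T * B * C * D"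
    and "A * F = e'\<^sup>2 * B * D + \<beta> * C\<^sup>2"
  shows "(e * C\<^sup>2 * g * s * q - e' * B * D * g' * r\<^sup>2) * (e * C\<^sup>2 * g' * t * r - e' * B * D * g * s\<^sup>2)
    = g * g' * ((B * C * t * q - A * D * s * r) * (C * D * t * q - B * F * s * r))"
  using assms by algebra

section \<open>The companion sequence and the addition formulas\<close>

text \<open>
  The elliptic divisibility sequence \<open>W\<close> attached to a Somos 4 sequence has \<open>W\<^sub>1 = 1\<close>,
  \<open>W\<^sub>2 = sqrt \<alpha>\<close>, \<open>W\<^sub>3 = -\<beta>\<close>, \<open>W\<^sub>4 = - sqrt \<alpha> J\<close> with \<open>J = \<alpha>\<^sup>2 + \<beta> T\<close>, and satisfies the same
  recurrence. The sequence below is \<open>W\<^sub>n\<close> for odd \<open>n\<close> and \<open>W\<^sub>n / sqrt \<alpha>\<close> for even \<open>n\<close>; its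
  recurrence is that of \<open>W\<close> after removing the common factor \<open>sqrt \<alpha>\<close> or \<open>\<alpha>\<close>, which leaves
  \<open>\<alpha>\<^sup>2\<close> or \<open>1\<close> as the first coefficient according to parity.
\<close>

fun companion :: "'a::field \<Rightarrow> 'a \<Rightarrow> 'a \<Rightarrow> nat \<Rightarrow> 'a" where
  "companion \<alpha> \<beta> J 0 = 0"
| "companion \<alpha> \<beta> J (Suc 0) = 1"
| "companion \<alpha> \<beta> J (Suc (Suc 0)) = 1"
| "companion \<alpha> \<beta> J (Suc (Suc (Suc 0))) = - \<beta>"
| "companion \<alpha> \<beta> J (Suc (Suc (Suc (Suc 0)))) = - J"
| "companion \<alpha> \<beta> J (Suc (Suc (Suc (Suc (Suc n))))) =
     ((parity_weight \<alpha> n)\<^sup>2 * companion \<alpha> \<beta> J (Suc (Suc n)) * companion \<alpha> \<beta> J (Suc (Suc (Suc (Suc n))))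
      + \<beta> * (companion \<alpha> \<beta> J (Suc (Suc (Suc n))))\<^sup>2) / companion \<alpha> \<beta> J (Suc n)"

lemma companion_initial:
  "companion \<alpha> \<beta> J 0 = 0" "companion \<alpha> \<beta> J 1 = 1" "companion \<alpha> \<beta> J 2 = 1"
  "companion \<alpha> \<beta> J 3 = - \<beta>" "companion \<alpha> \<beta> J 4 = - J"
  by (simp_all add: eval_nat_numeral)

locale companion_nonzero =
  fixes \<alpha> \<beta> T :: "'a::field"
  assumes alpha_nonzero: "\<alpha> \<noteq> 0"
    and companion_nonzero: "\<And>n. companion \<alpha> \<beta> (\<alpha>\<^sup>2 + \<beta> * T) (Suc n) \<noteq> 0"
begin

abbreviation w :: "nat \<Rightarrow> 'a" where
  "w \<equiv> companion \<alpha> \<beta> (\<alpha>\<^sup>2 + \<beta> * T)"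

abbreviation \<epsilon> :: "nat \<Rightarrow> 'a" where
  "\<epsilon> \<equiv> parity_weight \<alpha>"

lemma companion_somos4: "w n * w (n + 4) = (\<epsilon> (n + 1))\<^sup>2 * w (n + 1) * w (n + 3) + \<beta> * (w (n + 2))\<^sup>2"
proof (cases n)
  case 0
  then show ?thesis
    by (simp add: companion_initial parity_weight_def)
next
  case (Suc k)
  have i: "n + 1 = Suc (Suc k)" "n + 2 = Suc (Suc (Suc k))" "n + 3 = Suc (Suc (Suc (Suc k)))"
    "n + 4 = Suc (Suc (Suc (Suc (Suc k))))"
    using Suc by simp_all
  have "\<epsilon> (Suc (Suc k)) = \<epsilon> k"
    by (simp add: parity_weight_def)
  then show ?thesis
    unfolding i companion.simps(6) using companion_nonzero[of k] Suc by simp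
qed

lemma companion_somos4_rel: "somos4_rel \<alpha> \<beta> \<epsilon> w n"
  unfolding somos4_rel_def using companion_somos4[of n] parity_weight_simps(2)[of \<alpha> n] by algebra

text \<open>
  The choice of \<open>J\<close> is made so that the companion sequence lies on the quartic with parameter \<open>T\<close>.
  Since \<open>w 0 = 0\<close>, the invariance argument starts at index one.
\<close>

lemma companion_quartic_cubic_rel: "quartic_rel \<alpha> \<beta> T \<epsilon> w n \<and> cubic_rel \<alpha> T \<epsilon> w n"
proof -
  have C0: "cubic_rel \<alpha> T \<epsilon> w 0"
    by (simp add: cubic_rel_def companion_initial[simplified] parity_weight_def algebra_simps power2_eq_square)
  have Q1: "quartic_rel \<alpha> \<beta> T \<epsilon> w (0 + 1)"
    by (rule quartic_from_cubic[OF companion_somos4_rel C0 parity_weight_simps(1)])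
  show ?thesis
  proof (cases n)
    case 0
    moreover have "quartic_rel \<alpha> \<beta> T \<epsilon> w 0"
      by (simp add: quartic_rel_def companion_initial[simplified] parity_weight_def)
    ultimately show ?thesis
      using C0 by simp
  next
    case (Suc k)
    let ?\<eta> = "\<lambda>n. \<epsilon> (Suc n)" and ?x = "\<lambda>n. w (Suc n)"
    have "somos4_rel \<alpha> \<beta> ?\<eta> ?x m" for m
      using companion_somos4_rel[of "Suc m"] by (simp add: somos4_rel_def)
    moreover have "?\<eta> (m + 2) = ?\<eta> m" for m
      by (simp add: parity_weight_def)
    moreover have "quartic_rel \<alpha> \<beta> T ?\<eta> ?x 0"
      using Q1 by (simp add: quartic_rel_def)
    ultimately have "quartic_rel \<alpha> \<beta> T ?\<eta> ?x k" "cubic_rel \<alpha> T ?\<eta> ?x k"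
      using quartic_cubic_invariant[of \<alpha> \<beta> ?\<eta> ?x T k] companion_nonzero parity_weight_simps(3)[OF alpha_nonzero]
      by blast+
    then show ?thesis
      using Suc by (simp add: quartic_rel_def cubic_rel_def)
  qed
qed

lemma companion_quartic:
  "(w n)\<^sup>2 * (w (n + 3))\<^sup>2 + (\<epsilon> n)\<^sup>2 * w n * w (n + 2) ^ 3 + (\<epsilon> (n + 1))\<^sup>2 * w (n + 1) ^ 3 * w (n + 3)
   + \<beta> * (w (n + 1))\<^sup>2 * (w (n + 2))\<^sup>2 = T * w n * w (n + 1) * w (n + 2) * w (n + 3)" (is "?l = ?r")
proof -
  have "\<alpha> * ?l = \<alpha> * ?r"
    using companion_quartic_cubic_rel[of n] parity_weight_simps(2)[of \<alpha> n]
    unfolding quartic_rel_def by algebra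
  then show ?thesis
    using alpha_nonzero by simp
qed

lemma companion_cubic:
  "w (n + 4) * (w (n + 1))\<^sup>2 + (w (n + 3))\<^sup>2 * w n + (\<epsilon> n)\<^sup>2 * w (n + 2) ^ 3
   = T * w (n + 1) * w (n + 2) * w (n + 3)" (is "?l = ?r")
proof -
  have "\<epsilon> (n + 1) * ?l = \<epsilon> (n + 1) * ?r"
    using companion_quartic_cubic_rel[of n] parity_weight_simps(2)[of \<alpha> n]
    unfolding cubic_rel_def by algebra
  then show ?thesis
    using parity_weight_simps(3)[OF alpha_nonzero] by simp
qed

text \<open>
  These are the addition formulas of elliptic sequences: with \<open>m = k + 1\<close> and centre \<open>a = i + m\<close> they
  express \<open>x\<^sub>a\<^sub>+\<^sub>m x\<^sub>a\<^sub>-\<^sub>m\<close> and \<open>x\<^sub>a\<^sub>+\<^sub>m\<^sub>+\<^sub>1 x\<^sub>a\<^sub>-\<^sub>m\<close> through the four terms \<open>x\<^sub>a\<^sub>-\<^sub>1, \<dots>, x\<^sub>a\<^sub>+\<^sub>2\<close> around the centre. The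
  induction on \<open>k\<close> uses only that products can be regrouped:
  \<open>x\<^sub>i x\<^sub>i\<^sub>+\<^sub>2\<^sub>k\<^sub>+\<^sub>4 = (x\<^sub>i x\<^sub>i\<^sub>+\<^sub>2\<^sub>k\<^sub>+\<^sub>3) (x\<^sub>i\<^sub>+\<^sub>1 x\<^sub>i\<^sub>+\<^sub>2\<^sub>k\<^sub>+\<^sub>4) / (x\<^sub>i\<^sub>+\<^sub>1 x\<^sub>i\<^sub>+\<^sub>2\<^sub>k\<^sub>+\<^sub>3)\<close> gives the next even formula, and
  \<open>x\<^sub>i x\<^sub>i\<^sub>+\<^sub>2\<^sub>k\<^sub>+\<^sub>5 = (x\<^sub>i x\<^sub>i\<^sub>+\<^sub>2\<^sub>k\<^sub>+\<^sub>4) (x\<^sub>i\<^sub>+\<^sub>1 x\<^sub>i\<^sub>+\<^sub>2\<^sub>k\<^sub>+\<^sub>5) / (x\<^sub>i\<^sub>+\<^sub>1 x\<^sub>i\<^sub>+\<^sub>2\<^sub>k\<^sub>+\<^sub>4)\<close> the next odd one.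
\<close>

lemma addition_formulas:
  assumes S: "\<And>n. somos4_rel \<alpha> \<beta> \<eta> x n" and period: "\<And>n. \<eta> (n + 2) = \<eta> n"
    and eta: "\<And>n. \<eta> n \<noteq> 0" and x: "\<And>n. x n \<noteq> 0" and Q0: "quartic_rel \<alpha> \<beta> T \<eta> x 0"
  shows "\<eta> i * x (i + 2 * k + 2) * x i
      = \<epsilon> (k + 1) * (w (k + 1))\<^sup>2 * \<eta> (i + k) * x (i + k + 2) * x (i + k)
        - \<epsilon> k * w k * w (k + 2) * \<eta> (i + k + 1) * (x (i + k + 1))\<^sup>2"
    and "x (i + 2 * k + 3) * x i
      = w (k + 1) * w (k + 2) * x (i + k + 3) * x (i + k) - w k * w (k + 3) * x (i + k + 2) * x (i + k + 1)"
proof -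
  let ?E = "\<lambda>k i. \<eta> i * x (i + 2 * k + 2) * x i
      = \<epsilon> (k + 1) * (w (k + 1))\<^sup>2 * \<eta> (i + k) * x (i + k + 2) * x (i + k)
        - \<epsilon> k * w k * w (k + 2) * \<eta> (i + k + 1) * (x (i + k + 1))\<^sup>2"
  let ?O = "\<lambda>k i. x (i + 2 * k + 3) * x i
      = w (k + 1) * w (k + 2) * x (i + k + 3) * x (i + k) - w k * w (k + 3) * x (i + k + 2) * x (i + k + 1)"
  have "\<forall>i. ?E k i \<and> ?O k i"
  proof (induction k)
    case 0
    show ?case
      by (simp add: companion_initial[simplified] parity_weight_def)
  next
    case (Suc k)
    define e e' where "e = \<epsilon> k" and "e' = \<epsilon> (k + 1)"
    have ee': "e * e' = \<alpha>" and eps: "\<epsilon> (Suc k) = e'" "\<epsilon> (Suc k + 1) = e"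
      using parity_weight_simps(1,2)[of \<alpha> k] unfolding e_def e'_def by simp_all
    define A B C D F where "A = w k" and "B = w (k + 1)" and "C = w (k + 2)" and "D = w (k + 3)"
      and "F = w (k + 4)"
    note ABCDF = A_def[symmetric] B_def[symmetric] C_def[symmetric] D_def[symmetric] F_def[symmetric]
    have w_quartic: "A\<^sup>2 * D\<^sup>2 + e\<^sup>2 * A * C ^ 3 + e'\<^sup>2 * B ^ 3 * D + \<beta> * B\<^sup>2 * C\<^sup>2 = T * A * B * C * D"
      using companion_quartic[of k] unfolding ABCDF e_def e'_def .
    have w_cubic: "F * B\<^sup>2 + D\<^sup>2 * A + e\<^sup>2 * C ^ 3 = T * B * C * D"
      using companion_cubic[of k] unfolding ABCDF e_def .
    have w_somos: "A * F = e'\<^sup>2 * B * D + \<beta> * C\<^sup>2"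
      using companion_somos4[of k] unfolding ABCDF e'_def .
    have w_Suc: "w (Suc k) = B" "w (Suc k + 1) = C" "w (Suc k + 2) = D" "w (Suc k + 3) = F"
      unfolding A_def B_def C_def D_def F_def by (simp_all add: eval_nat_numeral)
    have E: "?E (Suc k) i" for i
    proof -
      define g g' where "g = \<eta> (i + k + 1)" and "g' = \<eta> (i + k)"
      define p q r s t where "p = x (i + k)" and "q = x (i + k + 1)" and "r = x (i + k + 2)"
        and "s = x (i + k + 3)" and "t = x (i + k + 4)"
      define u v where "u = x (i + 2 * k + 3)" and "v = x (i + 2 * k + 4)"
      \<comment> \<open>Neighbouring weights have the same product everywhere, as \<open>\<eta>\<close> has period two.\<close>
      have per: "\<eta> i * \<eta> (i + 1) = g * g'"
        unfolding g_def g'_def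
      proof (induction k)
        case (Suc k)
        then show ?case
          using period[of "i + k"] by simp
      qed simp
      have O1: "u * x i = B * C * s * p - A * D * r * q"
        using Suc[rule_format, of i] by (simp add: A_def B_def C_def D_def p_def q_def r_def s_def u_def)
      have O2: "v * x (i + 1) = B * C * t * q - A * D * s * r"
        using Suc[rule_format, of "i + 1"]
        by (simp add: A_def B_def C_def D_def q_def r_def s_def t_def v_def eval_nat_numeral)
      have E1: "\<eta> (i + 1) * u * x (i + 1) = e' * B\<^sup>2 * g * s * q - e * A * C * g' * r\<^sup>2"
        using Suc[rule_format, of "i + 1"] period[of "i + k"]
        by (simp add: A_def B_def C_def g_def g'_def q_def r_def s_def u_def e_def e'_def eval_nat_numeral)
      have "g * g' * ((B * C * s * p - A * D * r * q) * (B * C * t * q - A * D * s * r)) =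
        (e' * B\<^sup>2 * g * s * q - e * A * C * g' * r\<^sup>2) * (e * C\<^sup>2 * g * s * q - e' * B * D * g' * r\<^sup>2)"
      proof (rule even_step_algebra[OF _ _ ee' w_quartic])
        show "g' * p * t = \<alpha> * g * q * s + \<beta> * g' * r\<^sup>2"
          using S[of "i + k"] unfolding somos4_rel_def g_def g'_def p_def q_def r_def s_def t_def .
        show "g * (t * q\<^sup>2 + s\<^sup>2 * p) + \<alpha> * g' * r ^ 3 = T * g * q * r * s"
          using quartic_cubic_invariant(2)[OF S period eta x Q0, of "i + k"]
          unfolding cubic_rel_def g_def g'_def p_def q_def r_def s_def t_def .
      qed
      then have "(\<eta> (i + 1) * u * x (i + 1)) * (\<eta> i * v * x i)
          = (\<eta> (i + 1) * u * x (i + 1)) * (e * C\<^sup>2 * g * s * q - e' * B * D * g' * r\<^sup>2)"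
        unfolding O1[symmetric] O2[symmetric] E1[symmetric] per[symmetric] by (simp add: mult_ac)
      moreover have "\<eta> (i + 1) * u * x (i + 1) \<noteq> 0"
        unfolding u_def using eta x by simp
      ultimately have "\<eta> i * v * x i = e * C\<^sup>2 * g * s * q - e' * B * D * g' * r\<^sup>2"
        by (simp only: mult_left_cancel not_False_eq_True)
      then show ?thesis
        unfolding eps w_Suc using period[of "i + k"]
        by (simp add: g_def g'_def q_def r_def s_def v_def eval_nat_numeral)
    qed
    have "?O (Suc k) i" for i
    proof -
      define g g' where "g = \<eta> (i + k + 1)" and "g' = \<eta> (i + k + 2)"
      define q r s t where "q = x (i + k + 1)" and "r = x (i + k + 2)"
        and "s = x (i + k + 3)" and "t = x (i + k + 4)"
      define v z where "v = x (i + 2 * k + 4)" and "z = x (i + 2 * k + 5)"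
      have per: "\<eta> i * \<eta> (i + 1) = g * g'"
        unfolding g_def g'_def
      proof (induction k)
        case 0
        then show ?case
          using period[of i] by simp
      next
        case (Suc k)
        then show ?case
          using period[of "i + k + 1"] by simp
      qed
      have O2: "v * x (i + 1) = B * C * t * q - A * D * s * r"
        using Suc[rule_format, of "i + 1"]
        by (simp add: A_def B_def C_def D_def q_def r_def s_def t_def v_def eval_nat_numeral)
      have E1: "\<eta> i * v * x i = e * C\<^sup>2 * g * s * q - e' * B * D * g' * r\<^sup>2"
        using E[of i] unfolding eps w_Suc
        by (simp add: g_def g'_def q_def r_def s_def v_def eval_nat_numeral)
      have E2: "\<eta> (i + 1) * z * x (i + 1) = e * C\<^sup>2 * g' * t * r - e' * B * D * g * s\<^sup>2"
        using E[of "i + 1"] period[of "i + k + 1"] unfolding eps w_Suc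
        by (simp add: g_def g'_def r_def s_def t_def z_def eval_nat_numeral)
      have "(e * C\<^sup>2 * g * s * q - e' * B * D * g' * r\<^sup>2) * (e * C\<^sup>2 * g' * t * r - e' * B * D * g * s\<^sup>2)
        = g * g' * ((B * C * t * q - A * D * s * r) * (C * D * t * q - B * F * s * r))"
      proof (rule odd_step_algebra[OF _ ee' w_cubic w_somos])
        have "i + k + 1 + 1 = i + k + 2" "i + k + 1 + 2 = i + k + 3" "i + k + 1 + 3 = i + k + 4"
          by simp_all
        then show "g * g' * q\<^sup>2 * t\<^sup>2 + \<alpha> * (g\<^sup>2 * q * s ^ 3 + g'\<^sup>2 * r ^ 3 * t) + \<beta> * g * g' * r\<^sup>2 * s\<^sup>2
            = T * g * g' * q * r * s * t"
          using quartic_cubic_invariant(1)[OF S period eta x Q0, of "i + k + 1"]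
          unfolding quartic_rel_def g_def g'_def q_def r_def s_def t_def by metis
      qed
      then have "(\<eta> i * \<eta> (i + 1) * v * x (i + 1)) * (z * x i)
          = (\<eta> i * \<eta> (i + 1) * v * x (i + 1)) * (C * D * t * q - B * F * s * r)"
        unfolding E1[symmetric] E2[symmetric] O2[symmetric] per[symmetric] by (simp add: mult_ac)
      moreover have "\<eta> i * \<eta> (i + 1) * v * x (i + 1) \<noteq> 0"
        unfolding v_def using eta x by simp
      ultimately have "z * x i = C * D * t * q - B * F * s * r"
        by (simp only: mult_left_cancel not_False_eq_True)
      then show ?thesis
        unfolding w_Suc by (simp add: q_def r_def s_def t_def z_def eval_nat_numeral)
    qed
    then show ?case
      using E by blast
  qed
  then show "?E k i" and "?O k i"
    by blast+
qed

end

section \<open>Duplication and the strong Laurent property\<close>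

definition is_subring :: "'a::ring_1 set \<Rightarrow> bool" where
  "is_subring R \<longleftrightarrow> 1 \<in> R \<and> (\<forall>a\<in>R. \<forall>b\<in>R. a - b \<in> R \<and> a * b \<in> R)"

lemma is_subringD:
  assumes "is_subring R"
  shows "1 \<in> R" "0 \<in> R"
    and "a \<in> R \<Longrightarrow> b \<in> R \<Longrightarrow> a - b \<in> R"
    and "a \<in> R \<Longrightarrow> b \<in> R \<Longrightarrow> a * b \<in> R"
    and "a \<in> R \<Longrightarrow> - a \<in> R"
    and "a \<in> R \<Longrightarrow> a ^ n \<in> R"
proof -
  show one: "1 \<in> R" and diff: "a \<in> R \<Longrightarrow> b \<in> R \<Longrightarrow> a - b \<in> R"
    and mult: "a \<in> R \<Longrightarrow> b \<in> R \<Longrightarrow> a * b \<in> R" for a b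
    using assms by (auto simp: is_subring_def)
  show zero: "0 \<in> R"
    using diff[OF one one] by simp
  show "a \<in> R \<Longrightarrow> - a \<in> R"
    using diff[OF zero, of a] by simp
  show "a \<in> R \<Longrightarrow> a ^ n \<in> R"
    by (induction n) (simp_all add: one mult)
qed

lemma even_odd_induct:
  fixes P :: "nat \<Rightarrow> bool"
  assumes base: "\<And>n. n < 4 \<Longrightarrow> P n"
    and even: "\<And>k. (\<And>m. m < 2 * k + 4 \<Longrightarrow> P m) \<Longrightarrow> P (2 * k + 4)"
    and odd: "\<And>k. (\<And>m. m < 2 * k + 5 \<Longrightarrow> P m) \<Longrightarrow> P (2 * k + 5)"
  shows "P n"
proof (induction n rule: less_induct)
  case (less n)
  consider "n < 4" | k where "n = 2 * k + 4" | k where "n = 2 * k + 5"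
  proof (cases "n < 4")
    case False
    then have "n = 2 * ((n - 4) div 2) + 4 \<or> n = 2 * ((n - 4) div 2) + 5"
      by presburger
    then show ?thesis
      using that by blast
  qed (use that in blast)
  then show ?case
    using less base even odd by cases blast+
qed

context companion_nonzero
begin

text \<open>
  The shifted companion sequence is itself a weighted Somos 4 sequence with initial term \<open>w 1 = 1\<close>, so
  the addition formulas at \<open>i = 0\<close> become division-free duplication formulas.
\<close>

lemma companion_duplication:
  "w (2 * k + 3) = (\<epsilon> (k + 1))\<^sup>2 * w (k + 1) ^ 3 * w (k + 3) - (\<epsilon> k)\<^sup>2 * w k * w (k + 2) ^ 3"
  "w (2 * k + 4) = w (k + 2) * ((w (k + 1))\<^sup>2 * w (k + 4) - w k * (w (k + 3))\<^sup>2)"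
proof -
  let ?\<eta> = "\<lambda>n. \<epsilon> (n + 1)" and ?x = "\<lambda>n. w (n + 1)"
  have S: "somos4_rel \<alpha> \<beta> ?\<eta> ?x m" for m
    using companion_somos4_rel[of "m + 1"] by (simp add: somos4_rel_def)
  have Q: "quartic_rel \<alpha> \<beta> T ?\<eta> ?x 0"
    using companion_quartic_cubic_rel[of 1] by (simp add: quartic_rel_def)
  have per: "?\<eta> (m + 2) = ?\<eta> m" for m
    by (simp add: parity_weight_def)
  have nz: "?\<eta> m \<noteq> 0" "?x m \<noteq> 0" for m
    using companion_nonzero parity_weight_simps(3)[OF alpha_nonzero] by simp_all
  have w1: "w (Suc 0) = 1" "\<epsilon> (Suc 0) = 1" "\<epsilon> (Suc (Suc k)) = \<epsilon> k"
    by (simp_all add: parity_weight_def)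
  show "w (2 * k + 3) = (\<epsilon> (k + 1))\<^sup>2 * w (k + 1) ^ 3 * w (k + 3) - (\<epsilon> k)\<^sup>2 * w k * w (k + 2) ^ 3"
    using addition_formulas(1)[OF S per nz Q, of 0 k] w1
    by (simp add: eval_nat_numeral algebra_simps)
  show "w (2 * k + 4) = w (k + 2) * ((w (k + 1))\<^sup>2 * w (k + 4) - w k * (w (k + 3))\<^sup>2)"
    using addition_formulas(2)[OF S per nz Q, of 0 k] w1
    by (simp add: eval_nat_numeral algebra_simps)
qed

text \<open>
  Despite the divisions in their definition, the companion terms are polynomials in \<open>\<alpha>\<close>, \<open>\<beta>\<close> and
  \<open>\<alpha>\<^sup>2 + \<beta> T\<close>: the duplication formulas compute them from earlier terms without dividing.
\<close>

lemma companion_in_subring: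
  assumes R: "is_subring R" and "\<alpha> \<in> R" "\<beta> \<in> R" "\<alpha>\<^sup>2 + \<beta> * T \<in> R"
  shows "w n \<in> R"
proof -
  note closed = is_subringD[OF R]
  have eps: "\<epsilon> m \<in> R" for m
    using assms closed(1) by (simp add: parity_weight_def)
  show ?thesis
  proof (induction n rule: even_odd_induct)
    case (1 n)
    then consider "n = 0" | "n = 1" | "n = 2" | "n = 3"
      by linarith
    then show ?case
      by cases (simp_all only: companion_initial closed assms)
  next
    case (2 k)
    show ?case
    proof (cases "k = 0")
      case True
      then show ?thesis
        using closed(5)[OF assms(4)] companion_initial(5)[of \<alpha> \<beta>] by simp
    next
      case False
      then have "w (k + 1) \<in> R" "w (k + 2) \<in> R" "w (k + 3) \<in> R" "w (k + 4) \<in> R" "w k \<in> R"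
        using 2 by simp_all
      then show ?thesis
        unfolding companion_duplication by (simp only: closed)
    qed
  next
    case (3 k)
    have "w (k + 1) \<in> R" "w (k + 1 + 1) \<in> R" "w (k + 1 + 2) \<in> R" "w (k + 1 + 3) \<in> R"
      using 3 by simp_all
    then have "w (2 * (k + 1) + 3) \<in> R"
      unfolding companion_duplication by (simp only: closed eps)
    then show ?case
      by (simp add: algebra_simps)
  qed
qed

text \<open>
  The Laurent property in its strong form. The addition formulas at \<open>i = 0\<close> give \<open>x\<^sub>n x\<^sub>0\<close> as a
  polynomial in earlier terms and companion terms, so \<open>x\<^sub>0\<close> is the only initial value whose inverse
  occurs.
\<close>

lemma somos4_in_subring:
  assumes S: "\<And>n. somos4_rel \<alpha> \<beta> (\<lambda>_. 1) x n" and Q: "quartic_rel \<alpha> \<beta> T (\<lambda>_. 1) x 0"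
    and nz: "\<And>n. x n \<noteq> 0"
    and R: "is_subring R" and "\<alpha> \<in> R" "\<beta> \<in> R" "\<alpha>\<^sup>2 + \<beta> * T \<in> R"
    and "x 0 \<in> R" "x 1 \<in> R" "x 2 \<in> R" "x 3 \<in> R" and inv: "inverse (x 0) \<in> R"
  shows "x n \<in> R"
proof -
  note closed = is_subringD[OF R]
  note w = companion_in_subring[OF R assms(5-7)]
  have eps: "\<epsilon> m \<in> R" for m
    using assms closed(1) by (simp add: parity_weight_def)
  have cancel: "y \<in> R" if "y * x 0 = u" "u \<in> R" for y u
  proof -
    have "y = u * inverse (x 0)"
      using that(1) nz[of 0] by (simp add: field_simps)
    then show ?thesis
      using closed(4)[OF that(2) inv] by simp
  qed
  show ?thesis
  proof (induction n rule: even_odd_induct)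
    case (1 n)
    then consider "n = 0" | "n = 1" | "n = 2" | "n = 3"
      by linarith
    then show ?case
      by cases (simp_all only: assms)
  next
    case (2 k)
    have x: "x (k + 1) \<in> R" "x (k + 2) \<in> R" "x (k + 3) \<in> R"
      using 2 by simp_all
    have "x (2 * k + 4) * x 0 = \<epsilon> (k + 2) * (w (k + 2))\<^sup>2 * x (k + 3) * x (k + 1)
        - \<epsilon> (k + 1) * w (k + 1) * w (k + 3) * (x (k + 2))\<^sup>2"
      using addition_formulas(1)[OF S _ _ nz Q, of 0 "k + 1"] by (simp add: eval_nat_numeral)
    then show ?case
      by (rule cancel) (simp only: closed eps w x)
  next
    case (3 k)
    have x: "x (k + 1) \<in> R" "x (k + 2) \<in> R" "x (k + 3) \<in> R" "x (k + 4) \<in> R"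
      using 3 by simp_all
    have "x (2 * k + 5) * x 0 = w (k + 2) * w (k + 3) * x (k + 4) * x (k + 1)
        - w (k + 1) * w (k + 4) * x (k + 3) * x (k + 2)"
      using addition_formulas(2)[OF S _ _ nz Q, of 0 "k + 1"] by (simp add: eval_nat_numeral)
    then show ?case
      by (rule cancel) (simp only: closed eps w x)
  qed
qed

text \<open>
  A Somos 4 sequence is also a Somos 5 sequence. This relation continues the sequence past a
  zero, where the Somos 4 recurrence reads \<open>0 = 0\<close>.
\<close>

lemma somos5:
  assumes S: "\<And>n. somos4_rel \<alpha> \<beta> (\<lambda>_. 1) x n" and Q: "quartic_rel \<alpha> \<beta> T (\<lambda>_. 1) x 0"
    and nz: "\<And>n. x n \<noteq> 0"
  shows "x (n + 5) * x n = (\<alpha>\<^sup>2 + \<beta> * T) * x (n + 3) * x (n + 2) - \<beta> * x (n + 4) * x (n + 1)"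
  using addition_formulas(2)[OF S _ _ nz Q, of n 1]
  by (simp add: eval_nat_numeral algebra_simps)

end

section \<open>Evaluation of rational functions and non-vanishing of the formal terms\<close>

lemma eval6_simps:
  "eval6 a b A1 A2 A3 A4 (P + Q) = eval6 a b A1 A2 A3 A4 P + eval6 a b A1 A2 A3 A4 Q"
  "eval6 a b A1 A2 A3 A4 (P - Q) = eval6 a b A1 A2 A3 A4 P - eval6 a b A1 A2 A3 A4 Q"
  "eval6 a b A1 A2 A3 A4 0 = 0"
  "eval6 a b A1 A2 A3 A4 1 = 1"
  "eval6 a b A1 A2 A3 A4 X_\<alpha> = a"
  "eval6 a b A1 A2 A3 A4 X_\<beta> = b"
  "eval6 a b A1 A2 A3 A4 X_1 = A1"
  "eval6 a b A1 A2 A3 A4 X_2 = A2"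
  "eval6 a b A1 A2 A3 A4 X_3 = A3"
  "eval6 a b A1 A2 A3 A4 X_4 = A4"
  by (simp_all add: eval6_def X_\<alpha>_def X_\<beta>_def X_1_def X_2_def X_3_def X_4_def)

locale evaluation =
  fixes a b A1 A2 A3 A4 :: int
begin

abbreviation ev :: "poly6 \<Rightarrow> int" where
  "ev \<equiv> eval6 a b A1 A2 A3 A4"

abbreviation val :: "ratfun6 \<Rightarrow> rat \<Rightarrow> bool" where
  "val \<equiv> has_value a b A1 A2 A3 A4"

lemma valI:
  assumes "ev Q \<noteq> 0" and "y = of_int (ev P) / of_int (ev Q)"
  shows "val (Fract P Q) y"
proof -
  have "Q \<noteq> 0"
    using assms(1) by (auto simp: eval6_simps)
  then show ?thesis
    using assms unfolding has_value_def by blast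
qed

lemma valE:
  assumes "val f y"
  obtains P Q where "Q \<noteq> 0" "f = Fract P Q" "ev Q \<noteq> 0" "y = of_int (ev P) / of_int (ev Q)"
  using assms unfolding has_value_def by blast

lemma val_const: "val (const_rf P) (of_int (ev P))"
  unfolding const_rf_def by (rule valI) (simp_all add: eval6_simps)

lemma val_1: "val 1 1"
  using val_const[of 1] by (simp add: const_rf_def One_fract_def eval6_simps)

lemma val_0: "val 0 0"
  using val_const[of 0] by (simp add: const_rf_def Zero_fract_def eval6_simps)

lemma val_add: "val f y \<Longrightarrow> val g z \<Longrightarrow> val (f + g) (y + z)"
  by (elim valE, clarsimp, rule valI) (simp_all add: eval6_simps eval6_mult add_frac_eq)

lemma val_diff: "val f y \<Longrightarrow> val g z \<Longrightarrow> val (f - g) (y - z)"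
  by (elim valE, clarsimp, rule valI) (simp_all add: eval6_simps eval6_mult diff_frac_eq)

lemma val_mult: "val f y \<Longrightarrow> val g z \<Longrightarrow> val (f * g) (y * z)"
  by (elim valE, clarsimp, rule valI) (simp_all add: eval6_simps eval6_mult)

lemma val_divide: "val f y \<Longrightarrow> val g z \<Longrightarrow> z \<noteq> 0 \<Longrightarrow> val (f / g) (y / z)"
  by (elim valE, clarsimp, rule valI) (simp_all add: eval6_simps eval6_mult)

lemma val_power: "val f y \<Longrightarrow> val (f ^ n) (y ^ n)"
  by (induction n) (simp_all add: val_1 val_mult)

lemma val_nonzero: "val f y \<Longrightarrow> y \<noteq> 0 \<Longrightarrow> f \<noteq> 0"
  using val_const[of 0] has_value_unique by (fastforce simp: const_rf_def Zero_fract_def eval6_simps)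

lemmas val_intros = val_add val_diff val_mult val_divide val_power val_0 val_1

lemma val_variables:
  "val (const_rf X_\<alpha>) (of_int a)" "val (const_rf X_\<beta>) (of_int b)"
  "val (somos4_formal 0) (of_int A1)" "val (somos4_formal 1) (of_int A2)"
  "val (somos4_formal 2) (of_int A3)" "val (somos4_formal 3) (of_int A4)"
  using val_const[of X_\<alpha>] val_const[of X_\<beta>] val_const[of X_1] val_const[of X_2]
    val_const[of X_3] val_const[of X_4]
  by (simp_all add: eval6_simps eval_nat_numeral)

end

text \<open>
  The parameter \<open>T\<close> that puts the initial quadruple on the quartic, as a rational function of the
  data.
\<close>

definition formal_T :: ratfun6 where
  "formal_T =
     ((somos4_formal 0)\<^sup>2 * (somos4_formal 3)\<^sup>2
      + const_rf X_\<alpha> * (somos4_formal 0 * somos4_formal 2 ^ 3 + somos4_formal 1 ^ 3 * somos4_formal 3)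
      + const_rf X_\<beta> * (somos4_formal 1)\<^sup>2 * (somos4_formal 2)\<^sup>2)
     / (somos4_formal 0 * somos4_formal 1 * somos4_formal 2 * somos4_formal 3)"

lemma (in evaluation) val_formal_T:
  assumes "quartic a b T A1 A2 A3 A4" and "A1 \<noteq> 0" "A2 \<noteq> 0" "A3 \<noteq> 0" "A4 \<noteq> 0"
  shows "val formal_T T"
proof -
  have "T = of_int (A1\<^sup>2 * A4\<^sup>2 + a * (A1 * A3 ^ 3 + A2 ^ 3 * A4) + b * A2\<^sup>2 * A3\<^sup>2)
      / of_int (A1 * A2 * A3 * A4)"
    using assms by (simp add: quartic_def field_simps)
  then have T: "T = ((of_int A1)\<^sup>2 * (of_int A4)\<^sup>2
      + of_int a * (of_int A1 * of_int A3 ^ 3 + of_int A2 ^ 3 * of_int A4)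
      + of_int b * (of_int A2)\<^sup>2 * (of_int A3)\<^sup>2)
      / (of_int A1 * of_int A2 * of_int A3 * of_int A4)"
    by simp
  show ?thesis
    unfolding T formal_T_def
    by (intro val_intros val_variables) (use assms(2-) in simp)
qed

lemma somos4_formal_rec:
  "somos4_formal (n + 4) = (const_rf X_\<alpha> * somos4_formal (n + 3) * somos4_formal (n + 1)
     + const_rf X_\<beta> * (somos4_formal (n + 2))\<^sup>2) / somos4_formal n"
  by (simp add: eval_nat_numeral)

text \<open>
  At \<open>\<alpha> = 4\<close>, \<open>\<beta> = -3\<close> and initial values \<open>1, 2, 3, 4\<close> everything is explicit: \<open>A\<^sub>n = n\<close>, \<open>T = 6\<close> and
  \<open>W\<^sub>n = n\<close>. This single point shows that no term of the formal Somos sequence and no formal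
  companion term of positive index is the zero function, so the divisions in the addition formulas are
  legitimate.
\<close>

interpretation linear_point: evaluation 4 "-3" 1 2 3 4 .

lemma formal_linear_value: "linear_point.val (somos4_formal n) (of_nat (n + 1))"
proof (induction n rule: less_induct)
  case (less n)
  have "n < 4 \<or> n = (n - 4) + 4"
    by linarith
  then consider "n = 0" | "n = 1" | "n = 2" | "n = 3" | m where "n = m + 4"
    by (auto simp: eval_nat_numeral less_Suc_eq)
  then show ?case
  proof cases
    case 5
    have v: "of_nat (n + 1) = (of_int 4 * of_nat (m + 3 + 1) * of_nat (m + 1 + 1)
        + of_int (- 3) * (of_nat (m + 2 + 1))\<^sup>2) / rat_of_nat (m + 1)"
      unfolding 5 by (simp add: field_simps power2_eq_square)
    show ?thesis
      unfolding v unfolding 5 somos4_formal_rec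
      by (intro linear_point.val_intros linear_point.val_variables less) (simp_all add: 5)
  qed (use linear_point.val_variables in simp_all)
qed

lemma formal_nonzero: "somos4_formal n \<noteq> 0"
  using linear_point.val_nonzero[OF formal_linear_value] by simp

lemma formal_T_linear_value: "linear_point.val formal_T 6"
  by (rule linear_point.val_formal_T) (simp_all add: quartic_def)

abbreviation formal_companion :: "nat \<Rightarrow> ratfun6" where
  "formal_companion \<equiv> companion (const_rf X_\<alpha>) (const_rf X_\<beta>)
     ((const_rf X_\<alpha>)\<^sup>2 + const_rf X_\<beta> * formal_T)"

lemma parity_weight_linear_value:
  "linear_point.val (parity_weight (const_rf X_\<alpha>) n) (parity_weight 4 n)"
  using linear_point.val_variables(1) linear_point.val_1 by (simp add: parity_weight_def)

text \<open>
  The halved values at even indices reflect \<open>W\<^sub>2 = sqrt 4 = 2\<close>.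
\<close>

lemma formal_companion_linear_value:
  "linear_point.val (formal_companion n) (if even n then of_nat n / 2 else of_nat n)"
proof (induction n rule: less_induct)
  case (less n)
  have "n < 5 \<or> n = (n - 5) + 5"
    by linarith
  then consider "n = 0" | "n = 1" | "n = 2" | "n = 3" | "n = 4" | m where "n = m + 5"
    by (auto simp: eval_nat_numeral less_Suc_eq)
  then show ?case
  proof cases
    case 1
    then show ?thesis
      using linear_point.val_0 by simp
  next
    case 2
    then show ?thesis
      using linear_point.val_1 by simp
  next
    case 3
    then show ?thesis
      using linear_point.val_1 by (simp add: companion_initial(3))
  next
    case 4
    have "linear_point.val (0 - const_rf X_\<beta>) (0 - of_int (- 3))"
      by (intro linear_point.val_intros linear_point.val_variables)
    then show ?thesis
      using 4 by (simp add: companion_initial(4))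
  next
    case 5
    have "linear_point.val (0 - ((const_rf X_\<alpha>)\<^sup>2 + const_rf X_\<beta> * formal_T))
        (0 - ((of_int 4)\<^sup>2 + of_int (- 3) * 6))"
      by (intro linear_point.val_intros linear_point.val_variables formal_T_linear_value)
    then show ?thesis
      using 5 by (simp add: companion_initial(5))
  next
    case 6
    have rec: "formal_companion n = ((parity_weight (const_rf X_\<alpha>) m)\<^sup>2 * formal_companion (m + 2) * formal_companion (m + 4)
      + const_rf X_\<beta> * (formal_companion (m + 3))\<^sup>2) / formal_companion (m + 1)"
      unfolding 6 by (simp add: eval_nat_numeral)
    let ?v = "\<lambda>n. if even n then of_nat n / 2 else (of_nat n :: rat)"
    have v: "?v n = ((parity_weight 4 m)\<^sup>2 * ?v (m + 2) * ?v (m + 4)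
        + of_int (- 3) * (?v (m + 3))\<^sup>2) / ?v (m + 1)"
      unfolding 6 by (simp add: field_simps power2_eq_square parity_weight_def)
    show ?thesis
      unfolding v rec
      by (intro linear_point.val_intros linear_point.val_variables parity_weight_linear_value less) (simp_all add: 6)
  qed
qed

interpretation formal: companion_nonzero "const_rf X_\<alpha>" "const_rf X_\<beta>" formal_T
proof
  show "const_rf X_\<alpha> \<noteq> 0"
    using linear_point.val_nonzero[OF linear_point.val_variables(1)] by simp
  show "formal_companion (Suc n) \<noteq> 0" for n
    using linear_point.val_nonzero[OF formal_companion_linear_value, of "Suc n"] by (auto split: if_splits)
qed

lemma formal_somos4_rel: "somos4_rel (const_rf X_\<alpha>) (const_rf X_\<beta>) (\<lambda>_. 1) somos4_formal n"
  unfolding somos4_rel_def somos4_formal_rec using formal_nonzero[of n] by (simp add: mult_ac)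

lemma quartic_rel_of_quotient:
  assumes "x 0 \<noteq> 0" "x 1 \<noteq> 0" "x 2 \<noteq> 0" "x 3 \<noteq> 0"
  shows "quartic_rel \<alpha> \<beta>
    (((x 0)\<^sup>2 * (x 3)\<^sup>2 + \<alpha> * (x 0 * x 2 ^ 3 + x 1 ^ 3 * x 3) + \<beta> * (x 1)\<^sup>2 * (x 2)\<^sup>2) / (x 0 * x 1 * x 2 * x 3))
    (\<lambda>_. 1) x 0"
  using assms by (simp add: quartic_rel_def eval_nat_numeral)

lemma formal_quartic_rel:
  "quartic_rel (const_rf X_\<alpha>) (const_rf X_\<beta>) formal_T (\<lambda>_. 1) somos4_formal n"
  by (rule quartic_cubic_invariant(1)[OF formal_somos4_rel _ _ formal_nonzero])
    (simp_all only: formal_T_def quartic_rel_of_quotient formal_nonzero one_neq_zero not_False_eq_True)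

section \<open>Integrality of the orbit\<close>

context evaluation
begin

definition integer_valued :: "ratfun6 set" where
  "integer_valued = {f. \<exists>z::int. val f (of_int z)}"

lemma is_subring_integer_valued: "is_subring integer_valued"
proof -
  have "1 \<in> integer_valued"
    using val_1 unfolding integer_valued_def by (metis mem_Collect_eq of_int_1)
  moreover have "f - g \<in> integer_valued \<and> f * g \<in> integer_valued"
    if "f \<in> integer_valued" "g \<in> integer_valued" for f g
  proof -
    obtain y z :: int where "val f (of_int y)" "val g (of_int z)"
      using \<open>f \<in> _\<close> \<open>g \<in> _\<close> unfolding integer_valued_def by blast
    then have "val (f - g) (of_int (y - z))" "val (f * g) (of_int (y * z))"
      unfolding of_int_diff of_int_mult by (rule val_diff val_mult; assumption)+
    then show ?thesis
      unfolding integer_valued_def by blast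
  qed
  ultimately show ?thesis
    by (simp add: is_subring_def)
qed

text \<open>
  The functions with an integer value at the given point form a subring. It contains the inverse of
  the first initial value because \<open>A1 = \<plusminus>1\<close>, and \<open>\<alpha>\<^sup>2 + \<beta> T\<close> because \<open>\<beta> T\<close> is an integer.
\<close>

lemma somos4_integer_valued:
  assumes "of_int b * T \<in> \<int>" and A1: "A1 = 1 \<or> A1 = - 1" and A: "A2 \<noteq> 0" "A3 \<noteq> 0" "A4 \<noteq> 0"
    and Q: "quartic a b T A1 A2 A3 A4"
  shows "somos4_formal n \<in> integer_valued"
proof (rule formal.somos4_in_subring[OF formal_somos4_rel formal_quartic_rel formal_nonzero
      is_subring_integer_valued])
  have intI: "f \<in> integer_valued" if "val f (of_int z)" for f z
    using that unfolding integer_valued_def by blast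
  show "const_rf X_\<alpha> \<in> integer_valued" "const_rf X_\<beta> \<in> integer_valued"
    "somos4_formal 0 \<in> integer_valued" "somos4_formal 1 \<in> integer_valued"
    "somos4_formal 2 \<in> integer_valued" "somos4_formal 3 \<in> integer_valued"
    by (rule intI[OF val_variables(1)] intI[OF val_variables(2)] intI[OF val_variables(3)]
        intI[OF val_variables(4)] intI[OF val_variables(5)] intI[OF val_variables(6)])+
  have A1': "A1 \<noteq> 0"
    using A1 by auto
  obtain t where t: "of_int b * T = of_int t"
    using assms(1) by (auto elim: Ints_cases)
  have "val ((const_rf X_\<alpha>)\<^sup>2 + const_rf X_\<beta> * formal_T) ((of_int a)\<^sup>2 + of_int b * T)"
    by (intro val_intros val_variables val_formal_T[OF Q A1' A])
  also have "(of_int a)\<^sup>2 + of_int b * T = of_int (a\<^sup>2 + t)"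
    using t by simp
  finally show "(const_rf X_\<alpha>)\<^sup>2 + const_rf X_\<beta> * formal_T \<in> integer_valued"
    by (rule intI)
  have "val (1 / somos4_formal 0) (1 / of_int A1)"
    by (intro val_intros val_variables) (use A1' in simp)
  moreover have "1 / of_int A1 = (of_int A1 :: rat)"
    using A1 by auto
  ultimately show "inverse (somos4_formal 0) \<in> integer_valued"
    using intI[of "1 / somos4_formal 0" A1] by (simp add: divide_inverse)
qed

lemma somos4_eq: "val (somos4_formal n) y \<Longrightarrow> somos4 a b A1 A2 A3 A4 n = y"
  unfolding somos4_def by (rule the_equality) (assumption, rule has_value_unique)

text \<open>
  Identities between rational functions survive evaluation, so the integer values keep the Somos 4 and
  Somos 5 recurrences and the quartic, even across zeros.
\<close>

lemma integer_orbit: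
  assumes "of_int b * T \<in> \<int>" and A1: "A1 = 1 \<or> A1 = - 1" and A: "A2 \<noteq> 0" "A3 \<noteq> 0" "A4 \<noteq> 0"
    and Q: "quartic a b T A1 A2 A3 A4"
  obtains z :: "nat \<Rightarrow> int" and J :: int
  where "\<And>n. somos4 a b A1 A2 A3 A4 n = of_int (z n)"
    and "z 0 = A1" "z 1 = A2" "z 2 = A3" "z 3 = A4"
    and "\<And>n. z (n + 4) * z n = a * z (n + 3) * z (n + 1) + b * (z (n + 2))\<^sup>2"
    and "\<And>n. z (n + 5) * z n = J * z (n + 3) * z (n + 2) - b * z (n + 4) * z (n + 1)"
    and "\<And>n. quartic a b T (z n) (z (n + 1)) (z (n + 2)) (z (n + 3))"
proof -
  have A1': "A1 \<noteq> 0"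
    using A1 by auto
  obtain t where t: "of_int b * T = of_int t"
    using assms(1) by (auto elim: Ints_cases)
  have "\<forall>n. \<exists>z::int. val (somos4_formal n) (of_int z)"
    using somos4_integer_valued[OF assms] unfolding integer_valued_def by blast
  then obtain z :: "nat \<Rightarrow> int" where z: "\<And>n. val (somos4_formal n) (of_int (z n))"
    by metis
  note z_eq = has_value_unique[OF z]
  note vals = val_intros val_variables z val_formal_T[OF Q A1' A]
  have init: "z 0 = A1" "z 1 = A2" "z 2 = A3" "z 3 = A4"
    using z_eq[OF val_variables(3)] z_eq[OF val_variables(4)] z_eq[OF val_variables(5)]
      z_eq[OF val_variables(6)] by simp_all
  have "z (n + 4) * z n = a * z (n + 3) * z (n + 1) + b * (z (n + 2))\<^sup>2" for n
  proof -
    have "val (somos4_formal (n + 4) * somos4_formal n) (of_int (z (n + 4)) * of_int (z n))"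
      by (intro vals)
    moreover have "val (const_rf X_\<alpha> * somos4_formal (n + 3) * somos4_formal (n + 1)
          + const_rf X_\<beta> * (somos4_formal (n + 2))\<^sup>2)
        (of_int a * of_int (z (n + 3)) * of_int (z (n + 1)) + of_int b * (of_int (z (n + 2)))\<^sup>2)"
      by (intro vals)
    moreover have "somos4_formal (n + 4) * somos4_formal n =
        const_rf X_\<alpha> * somos4_formal (n + 3) * somos4_formal (n + 1)
          + const_rf X_\<beta> * (somos4_formal (n + 2))\<^sup>2"
      using formal_nonzero[of n] unfolding somos4_formal_rec by simp
    ultimately have "rat_of_int (z (n + 4)) * of_int (z n) =
        of_int a * of_int (z (n + 3)) * of_int (z (n + 1)) + of_int b * (of_int (z (n + 2)))\<^sup>2"
      using has_value_unique by metis
    then show ?thesis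
      unfolding of_int_mult[symmetric] of_int_add[symmetric] of_int_power[symmetric] of_int_eq_iff .
  qed
  moreover have "z (n + 5) * z n = (a\<^sup>2 + t) * z (n + 3) * z (n + 2) - b * z (n + 4) * z (n + 1)" for n
  proof -
    have "val (somos4_formal (n + 5) * somos4_formal n) (of_int (z (n + 5)) * of_int (z n))"
      by (intro vals)
    moreover have "val (((const_rf X_\<alpha>)\<^sup>2 + const_rf X_\<beta> * formal_T) * somos4_formal (n + 3) * somos4_formal (n + 2)
          - const_rf X_\<beta> * somos4_formal (n + 4) * somos4_formal (n + 1))
        (((of_int a)\<^sup>2 + of_int b * T) * of_int (z (n + 3)) * of_int (z (n + 2))
          - of_int b * of_int (z (n + 4)) * of_int (z (n + 1)))"
      by (intro vals)
    moreover note formal.somos5[OF formal_somos4_rel formal_quartic_rel formal_nonzero, of n]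
    ultimately have "rat_of_int (z (n + 5)) * of_int (z n) =
        ((of_int a)\<^sup>2 + of_int t) * of_int (z (n + 3)) * of_int (z (n + 2))
          - of_int b * of_int (z (n + 4)) * of_int (z (n + 1))"
      using has_value_unique unfolding t by metis
    then show ?thesis
      unfolding of_int_mult[symmetric] of_int_add[symmetric] of_int_diff[symmetric]
        of_int_power[symmetric] of_int_eq_iff .
  qed
  moreover have "quartic a b T (z n) (z (n + 1)) (z (n + 2)) (z (n + 3))" for n
  proof -
    let ?l = "(somos4_formal n)\<^sup>2 * (somos4_formal (n + 3))\<^sup>2
        + const_rf X_\<alpha> * (somos4_formal n * somos4_formal (n + 2) ^ 3 + somos4_formal (n + 1) ^ 3 * somos4_formal (n + 3))
        + const_rf X_\<beta> * (somos4_formal (n + 1))\<^sup>2 * (somos4_formal (n + 2))\<^sup>2"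
    let ?r = "formal_T * (somos4_formal n * somos4_formal (n + 1) * somos4_formal (n + 2) * somos4_formal (n + 3))"
    have "val ?l ((of_int (z n))\<^sup>2 * (of_int (z (n + 3)))\<^sup>2
        + of_int a * (of_int (z n) * of_int (z (n + 2)) ^ 3 + of_int (z (n + 1)) ^ 3 * of_int (z (n + 3)))
        + of_int b * (of_int (z (n + 1)))\<^sup>2 * (of_int (z (n + 2)))\<^sup>2)"
      by (intro vals)
    moreover have "val ?r (T * (of_int (z n) * of_int (z (n + 1)) * of_int (z (n + 2)) * of_int (z (n + 3))))"
      by (intro vals)
    moreover have "?l = ?r"
      using formal_quartic_rel[of n] by (simp only: quartic_rel_def mult_1_right power_one mult_1_left mult.assoc)
    ultimately show ?thesis
      unfolding quartic_def of_int_add of_int_mult of_int_power using has_value_unique by metis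
  qed
  ultimately show ?thesis
    using that[of z "a\<^sup>2 + t"] somos4_eq[OF z] init by blast
qed

end

section \<open>Finite orbits are periodic\<close>

text \<open>
  If one of \<open>a\<close>, \<open>b\<close> is zero, the right-hand side of the recurrence is a single product and no term
  ever vanishes. Otherwise any four consecutive terms contain at most one zero: if \<open>z (n + 4) = 0\<close>, then
  \<open>a z\<^sub>n\<^sub>+\<^sub>3 z\<^sub>n\<^sub>+\<^sub>1 = - b (z\<^sub>n\<^sub>+\<^sub>2)\<^sup>2\<close>, so a zero among these three would force a second one.
\<close>

lemma no_adjacent_zeros:
  fixes z :: "nat \<Rightarrow> 'a::idom"
  assumes rec: "\<And>n. z (n + 4) * z n = a * z (n + 3) * z (n + 1) + b * (z (n + 2))\<^sup>2"
    and ab: "a \<noteq> 0 \<or> b \<noteq> 0" and init: "z 0 \<noteq> 0" "z 1 \<noteq> 0" "z 2 \<noteq> 0" "z 3 \<noteq> 0"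
  shows "z n \<noteq> 0 \<or> z (n + 1) \<noteq> 0"
proof (cases "a = 0 \<or> b = 0")
  case True
  have "z n \<noteq> 0 \<and> z (n + 1) \<noteq> 0 \<and> z (n + 2) \<noteq> 0 \<and> z (n + 3) \<noteq> 0"
  proof (induction n)
    case 0
    show ?case
      using init by (simp add: eval_nat_numeral)
  next
    case (Suc n)
    have "z (n + 4) * z n \<noteq> 0"
      unfolding rec using Suc ab True by auto
    then show ?case
      using Suc by (auto simp: eval_nat_numeral)
  qed
  then show ?thesis
    by blast
next
  case False
  have "(z n \<noteq> 0 \<or> z (n + 1) \<noteq> 0) \<and> (z n \<noteq> 0 \<or> z (n + 2) \<noteq> 0) \<and> (z n \<noteq> 0 \<or> z (n + 3) \<noteq> 0)
    \<and> (z (n + 1) \<noteq> 0 \<or> z (n + 2) \<noteq> 0) \<and> (z (n + 1) \<noteq> 0 \<or> z (n + 3) \<noteq> 0)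
    \<and> (z (n + 2) \<noteq> 0 \<or> z (n + 3) \<noteq> 0)"
  proof (induction n)
    case 0
    show ?case
      using init by (simp add: eval_nat_numeral)
  next
    case (Suc n)
    have "z (n + 1) \<noteq> 0 \<and> z (n + 2) \<noteq> 0 \<and> z (n + 3) \<noteq> 0" if "z (n + 4) = 0"
      using rec[of n] Suc False that by (auto simp: add_eq_0_iff)
    then show ?case
      using Suc by (auto simp: eval_nat_numeral)
  qed
  then show ?thesis
    by blast
qed

text \<open>
  Two equal states exist by the pigeonhole principle; reversibility carries the coincidence back to
  index \<open>0\<close>, which is why the period is pure.
\<close>

lemma finite_reversible_orbit_periodic:
  assumes fin: "finite (range f)"
    and fwd: "\<And>m n. f m = f n \<Longrightarrow> f (Suc m) = f (Suc n)"
    and bwd: "\<And>m n. f (Suc m) = f (Suc n) \<Longrightarrow> f m = f n"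
  shows "periodic f"
proof -
  have "\<not> inj f"
    using fin finite_imageD infinite_UNIV_nat by blast
  then obtain i j where "i < j" "f i = f j"
    unfolding inj_def by (metis linorder_neqE_nat)
  then obtain p where p: "p \<ge> 1" and ip: "f (i + p) = f i"
    by (intro that[of "j - i"]) simp_all
  have "f (0 + p) = f 0"
    using ip
  proof (induction i)
    case (Suc i)
    then show ?case
      using bwd[of "i + p" i] by simp
  qed
  then have "f (n + p) = f n" for n
  proof (induction n)
    case (Suc n)
    then show ?case
      using fwd[of "n + p" n] by simp
  qed
  then show ?thesis
    using p unfolding periodic_def by blast
qed

text \<open>
  Five consecutive terms determine the next one and the previous one: the Somos 4 recurrence works
  unless the term to divide by is zero, and then its neighbour is non-zero and the Somos 5 recurrence
  works. Four terms would not suffice at a zero.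
\<close>

lemma finite_orbit_imp_periodic:
  fixes z :: "nat \<Rightarrow> 'a::idom"
  assumes somos4: "\<And>n. z (n + 4) * z n = a * z (n + 3) * z (n + 1) + b * (z (n + 2))\<^sup>2"
    and somos5: "\<And>n. z (n + 5) * z n = J * z (n + 3) * z (n + 2) - b * z (n + 4) * z (n + 1)"
    and adj: "\<And>n. z n \<noteq> 0 \<or> z (n + 1) \<noteq> 0"
    and fin: "finite (range z)"
  shows "periodic z"
proof -
  let ?f = "\<lambda>n. (z n, z (n + 1), z (n + 2), z (n + 3), z (n + 4))"
  have "range ?f \<subseteq> range z \<times> range z \<times> range z \<times> range z \<times> range z"
    by auto
  then have "finite (range ?f)"
    using fin by (meson finite_SigmaI finite_subset)
  then have "periodic ?f"
  proof (rule finite_reversible_orbit_periodic)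
    fix m n
    assume eq: "?f m = ?f n"
    have "z (m + 5) = z (n + 5)"
    proof (cases "z (m + 1) = 0")
      case True
      then have "z m \<noteq> 0"
        using adj[of m] by simp
      moreover have "z (m + 5) * z m = z (n + 5) * z m"
        using somos5[of m] somos5[of n] eq by simp
      ultimately show ?thesis
        by simp
    next
      case False
      moreover have "z (m + 5) * z (m + 1) = z (n + 5) * z (m + 1)"
        using somos4[of "m + 1"] somos4[of "n + 1"] eq by (simp add: eval_nat_numeral)
      ultimately show ?thesis
        by simp
    qed
    then show "?f (Suc m) = ?f (Suc n)"
      using eq by (simp add: eval_nat_numeral)
  next
    fix m n
    assume "?f (Suc m) = ?f (Suc n)"
    then have eq: "z (m + 1) = z (n + 1)" "z (m + 2) = z (n + 2)" "z (m + 3) = z (n + 3)"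
      "z (m + 4) = z (n + 4)" "z (m + 5) = z (n + 5)"
      by (simp_all add: eval_nat_numeral)
    have "z m = z n"
    proof (cases "z (m + 4) = 0")
      case True
      then have "z (m + 5) \<noteq> 0"
        using adj[of "m + 4"] by (simp add: eval_nat_numeral)
      moreover have "z (m + 5) * z m = z (m + 5) * z n"
        using somos5[of m] somos5[of n] eq by simp
      ultimately show ?thesis
        by simp
    next
      case False
      moreover have "z (m + 4) * z m = z (m + 4) * z n"
        using somos4[of m] somos4[of n] eq by simp
      ultimately show ?thesis
        by simp
    qed
    then show "?f m = ?f n"
      using eq by simp
  qed
  then show ?thesis
    unfolding periodic_def by blast
qed

theorem corollary3p3:
  fixes \<alpha> \<beta> A1 A2 A3 A4 :: int and T :: rat
  assumes "of_int \<beta> * T \<in> \<int>"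
    and "\<alpha> \<noteq> 0 \<or> \<beta> \<noteq> 0"
    and "A1 = 1 \<or> A1 = -1"
    and "A2 \<noteq> 0" and "A3 \<noteq> 0" and "A4 \<noteq> 0"
    and "quartic \<alpha> \<beta> T A1 A2 A3 A4"
    and "\<not> periodic (somos4 \<alpha> \<beta> A1 A2 A3 A4)"
  shows "infinite {(s, t, u, v). quartic \<alpha> \<beta> T s t u v \<and>
    (\<exists>n. somos4 \<alpha> \<beta> A1 A2 A3 A4 n = of_int s \<and>
         somos4 \<alpha> \<beta> A1 A2 A3 A4 (n + 1) = of_int t \<and>
         somos4 \<alpha> \<beta> A1 A2 A3 A4 (n + 2) = of_int u \<and>
         somos4 \<alpha> \<beta> A1 A2 A3 A4 (n + 3) = of_int v)}"
    (is "infinite ?S")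
proof
  assume fin: "finite ?S"
  obtain z :: "nat \<Rightarrow> int" and J :: int
    where z: "\<And>n. somos4 \<alpha> \<beta> A1 A2 A3 A4 n = of_int (z n)"
      and init: "z 0 = A1" "z 1 = A2" "z 2 = A3" "z 3 = A4"
      and somos4: "\<And>n. z (n + 4) * z n = \<alpha> * z (n + 3) * z (n + 1) + \<beta> * (z (n + 2))\<^sup>2"
      and somos5: "\<And>n. z (n + 5) * z n = J * z (n + 3) * z (n + 2) - \<beta> * z (n + 4) * z (n + 1)"
      and Q: "\<And>n. quartic \<alpha> \<beta> T (z n) (z (n + 1)) (z (n + 2)) (z (n + 3))"
    using evaluation.integer_orbit[OF assms(1,3-7)] by metis
  have "z n \<in> fst ` ?S" for n
  proof -
    have "(z n, z (n + 1), z (n + 2), z (n + 3)) \<in> ?S"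
      using Q[of n] z by blast
    then show ?thesis
      by (force simp del: of_int_eq_iff)
  qed
  then have "finite (range z)"
    using fin by (meson finite_imageI finite_subset image_subsetI)
  moreover have "z n \<noteq> 0 \<or> z (n + 1) \<noteq> 0" for n
    using no_adjacent_zeros[OF somos4 assms(2)] init assms(3-6) by auto
  ultimately have "periodic z"
    using finite_orbit_imp_periodic[OF somos4 somos5] by blast
  then have "periodic (somos4 \<alpha> \<beta> A1 A2 A3 A4)"
    unfolding periodic_def z by simp
  then show False
    using assms(8) by contradiction
qed

end
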